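(* Let $\Sigma$ be a finite alphabet and $\mathbb{D}$ a value domain. For every property $\varPhi : \Sigma^\omega \to \mathbb{D}$, there exists a live property $\varPsi : \Sigma^\omega \to \mathbb{D}$ such that $\varPhi(w) = \min(\mathit{SafetyCl}(\varPhi)(w), \varPsi(w))$ for all $w \in \Sigma^\omega$.
   Context: $\Sigma^*$ and $\Sigma^\omega$ are the sets of finite and infinite words over the finite nonempty alphabet $\Sigma$; $u \prec w$ means that the finite word $u$ is a strict prefix of $w$ (the empty word is allowed). A value domain $\mathbb{D}$ is a complete lattice with $\bot \neq \top$; $\min$ denotes the binary greatest lower bound (meet). A property is a total function $\Sigma^\omega \to \mathbb{D}$. The safety closure of $\varPhi$ is defined by $\mathit{SafetyCl}(\varPhi)(w) = \inf_{u \prec w} \sup_{w' \in \Sigma^\omega} \varPhi(uw')$. A property $\varPsi$ is live in a domain $\mathbb{D}'$ when for all $w \in \Sigma^\omega$, if $\varPsi(w) < \sup \mathbb{D}'$, then there exists a value $v \in \mathbb{D}'$ such that $\varPsi(w) \not\geq v$ and for all prefixes $u \prec w$ we have $\sup_{w' \in \Sigma^\omega} \varPsi(uw') \geq v$. Convention: "$\varPsi$ is live" (with no domain mentioned) means that $\varPsi$ is live in $\mathbb{D}_\varPsi = \{v \in \mathbb{D} : v \leq \sup_{w \in \Sigma^\omega} \varPsi(w)\}$. *)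

theory Defs
  imports Main "HOL-Library.Stream"
begin

text \<open>
  The alphabet is a type \<open>'a\<close> of class \<open>finite\<close> (types are nonempty), so infinite words are
  \<open>'a stream\<close>. A property is a function \<open>'a stream \<Rightarrow> 'd\<close> into a complete lattice \<open>'d\<close>;
  the nontriviality of the value domain is an explicit assumption where needed.
\<close>

definition word_prefix :: "'a list \<Rightarrow> 'a stream \<Rightarrow> bool"  (infix "\<prec>" 50) where
  "u \<prec> w \<longleftrightarrow> (\<exists>w'. w = u @- w')"

definition safety_cl :: "('a stream \<Rightarrow> 'd::complete_lattice) \<Rightarrow> 'a stream \<Rightarrow> 'd" where
  "safety_cl \<Phi> w = (INF u \<in> {u. u \<prec> w}. SUP w'. \<Phi> (u @- w'))"

definition live_in :: "'d::complete_lattice set \<Rightarrow> ('a stream \<Rightarrow> 'd) \<Rightarrow> bool" where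
  "live_in D \<Psi> \<longleftrightarrow>
     (\<forall>w. \<Psi> w < Sup D \<longrightarrow>
        (\<exists>v\<in>D. \<not> \<Psi> w \<ge> v \<and> (\<forall>u. u \<prec> w \<longrightarrow> (SUP w'. \<Psi> (u @- w')) \<ge> v)))"

definition values_below_sup :: "('a stream \<Rightarrow> 'd::complete_lattice) \<Rightarrow> 'd set" where
  "values_below_sup \<Psi> = {v. v \<le> (SUP w. \<Psi> w)}"

definition live :: "('a stream \<Rightarrow> 'd::complete_lattice) \<Rightarrow> bool" where
  "live \<Psi> \<longleftrightarrow> live_in (values_below_sup \<Psi>) \<Psi>"

end

theory Submission
  imports Defs
begin

text \<open>Let \<Psi> be \<open>top\<close> where \<Phi> agrees with its safety closure, and \<Phi>
  elsewhere. As \<Phi> lies below its closure (\<open>le_safety_cl\<close>), the meet of closure and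
  \<Psi> is \<Phi> in both cases. Where \<Psi> is not \<open>top\<close>, the closure is strictly
  above \<Phi> = \<Psi>, and this gap makes \<Psi> live
  (\<open>live_if_ge_and_safety_cl_not_le\<close>).\<close>

lemma le_safety_cl: "\<Phi> w \<le> safety_cl \<Phi> w"
  unfolding safety_cl_def word_prefix_def by (auto intro!: INF_greatest SUP_upper)

lemma safety_cl_le_SUP: "u \<prec> w \<Longrightarrow> safety_cl \<Phi> w \<le> (SUP w'. \<Phi> (u @- w'))"
  unfolding safety_cl_def by (auto intro: INF_lower)

text \<open>The witness for liveness at \<open>w\<close> is \<open>safety_cl \<Phi> w\<close>: it
  lies below the supremum of \<Phi> over the extensions of each prefix of \<open>w\<close>, hence
  below that of the larger \<Psi>.\<close>

lemma live_if_ge_and_safety_cl_not_le: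
  assumes ge: "\<And>w. \<Phi> w \<le> \<Psi> w"
    and gap: "\<And>w. \<Psi> w \<noteq> top \<Longrightarrow> \<not> safety_cl \<Phi> w \<le> \<Psi> w"
  shows "live \<Psi>"
  unfolding live_def live_in_def
proof (intro allI impI)
  fix w
  assume "\<Psi> w < Sup (values_below_sup \<Psi>)"
  then have "\<not> safety_cl \<Phi> w \<le> \<Psi> w"
    by (intro gap) (auto simp: top.extremum_strict)
  moreover have bound: "safety_cl \<Phi> w \<le> (SUP w'. \<Psi> (u @- w'))" if "u \<prec> w" for u
    using safety_cl_le_SUP[OF that, of \<Phi>] by (rule order_trans) (intro SUP_mono' ge)
  \<comment> \<open>For the empty prefix, the supremum in \<open>bound\<close> ranges over all
    words.\<close>
  moreover have "safety_cl \<Phi> w \<in> values_below_sup \<Psi>"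
    using bound[of "[]"] by (simp add: values_below_sup_def word_prefix_def)
  ultimately show "\<exists>v\<in>values_below_sup \<Psi>. \<not> \<Psi> w \<ge> v \<and>
      (\<forall>u. u \<prec> w \<longrightarrow> (SUP w'. \<Psi> (u @- w')) \<ge> v)"
    by blast
qed

theorem theorem5p13:
  fixes \<Phi> :: "'a::finite stream \<Rightarrow> 'd::complete_lattice"
  assumes "(bot :: 'd) \<noteq> top"
  shows "\<exists>\<Psi> :: 'a stream \<Rightarrow> 'd. live \<Psi> \<and> (\<forall>w. \<Phi> w = inf (safety_cl \<Phi> w) (\<Psi> w))"
proof (intro exI conjI allI)
  let ?\<Psi> = "\<lambda>w. if safety_cl \<Phi> w = \<Phi> w then top else \<Phi> w"
  show "live ?\<Psi>"
    by (rule live_if_ge_and_safety_cl_not_le[of \<Phi>])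
      (auto dest: order.antisym[OF le_safety_cl] split: if_splits)
  show "\<Phi> w = inf (safety_cl \<Phi> w) (?\<Psi> w)" for w
    by (simp add: inf_absorb2 le_safety_cl)
qed

end
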